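(* Let $A\in\mathbb{C}^{N\times N}$ and $\mathbf b\in\mathbb{C}^N$, let $\mathbf x\in\mathbb{C}^N$ be a solution of $A\mathbf x=\mathbf b$, let $\mathbf x_0\in\mathbb{C}^N$, $\mathbf r_0=\mathbf b-A\mathbf x_0$ and $\boldsymbol\eta_0=\mathbf x-\mathbf x_0$. Let $U\in\mathbb{C}^{N\times k}$, let $V_m\in\mathbb{C}^{N\times m}$ and $\mathbf V_m=[U,V_m]$. Let $\varepsilon\in[0,1)$ and let $S\in\mathbb{C}^{s\times N}$. Define $$\widehat\Phi_U=AU(SAU)^\dagger S,\qquad\widehat\Pi_U=U(SAU)^\dagger SA .$$ For $U$ such that $\mathrm{Range}(AU)$ satisfies the sketching assumption, that is, $(1-\varepsilon)\|\mathbf v\|^2\le\|S\mathbf v\|^2\le(1+\varepsilon)\|\mathbf v\|^2$ for all $\mathbf v\in\mathrm{Range}(AU)$, and for $m$ not too large, if the columns of $SA\mathbf V_m$ are linearly independent, then applying augmented sketched GMRES for the augmented space $\mathrm{Range}(\mathbf V_m)$ is equivalent to applying a sketched GMRES iteration to the equation $$(I-\widehat\Phi_U)A\mathbf t=(I-\widehat\Phi_U)\mathbf r_0,$$ selecting $\widetilde{\mathbf t}_m=V_m\widetilde{\mathbf y}_m\in\mathrm{Range}(V_m)$ according to $$\widetilde{\mathbf y}_m=\underset{\mathbf y\in\mathbb{C}^m}{\mathrm{argmin}}\left\|S(I-\widehat\Phi_U)(\mathbf r_0-AV_m\mathbf y)\right\|,$$ and constructing $$\widetilde{\mathbf x}_m=\mathbf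 x_0+\widehat\Pi_U\boldsymbol\eta_0+(I-\widehat\Pi_U)\widetilde{\mathbf t}_m .$$ That is, the vector $\widetilde{\mathbf x}_m$ so constructed is exactly the augmented sketched GMRES approximation.
   Context: $\dagger$ denotes the Moore--Penrose pseudoinverse and $\|\cdot\|$ the Euclidean norm. The augmented sketched GMRES approximation over the augmented space $\mathrm{Range}(\mathbf V_m)$ is $\widetilde{\mathbf x}_m=\mathbf x_0+\widetilde{\mathbf f}$ with $\widetilde{\mathbf f}\in\mathrm{Range}(\mathbf V_m)$ minimizing $\|S(\mathbf b-A(\mathbf x_0+\mathbf f))\|$ over $\mathbf f\in\mathrm{Range}(\mathbf V_m)$; equivalently $\widetilde{\mathbf x}_m=\mathbf x_0+U\widetilde{\mathbf z}_m+V_m\widetilde{\mathbf y}_m$ where $(\widetilde{\mathbf z}_m,\widetilde{\mathbf y}_m)\in\mathbb{C}^k\times\mathbb{C}^m$ solves the normal equations $(SA\mathbf V_m)^*SA\mathbf V_m\begin{bmatrix}\mathbf z\\\mathbf y\end{bmatrix}=(SA\mathbf V_m)^*S\mathbf r_0$. The hypothesis "for $m$ not too large" is part of the statement as given; no explicit bound on $m$ is specified. *)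

theory Defs
  imports "HOL-Analysis.Analysis"
begin

text \<open>A complex matrix with rows indexed by \<open>'a\<close> and columns indexed by \<open>'b\<close> has type
  \<open>complex ^ 'b ^ 'a\<close>; \<open>norm\<close> on \<open>complex ^ 'a\<close> is the Euclidean norm.\<close>

definition ctranspose :: "complex ^ 'b ^ 'a \<Rightarrow> complex ^ 'a ^ 'b"
  where "ctranspose M = (\<chi> i j. cnj (M $ j $ i))"

definition is_pseudo_inverse :: "complex ^ 'b ^ 'a \<Rightarrow> complex ^ 'a ^ 'b \<Rightarrow> bool"
  where "is_pseudo_inverse M X \<longleftrightarrow>
    M ** X ** M = M \<and> X ** M ** X = X \<and>
    ctranspose (M ** X) = M ** X \<and> ctranspose (X ** M) = X ** M"

lemma ctranspose_mult: "ctranspose (M ** X) = ctranspose X ** ctranspose M"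
  by (simp add: ctranspose_def matrix_matrix_mult_def vec_eq_iff mult.commute)

lemma is_pseudo_inverse_unique:
  assumes X: "is_pseudo_inverse M X" and Y: "is_pseudo_inverse M Y"
  shows "X = Y"
proof -
  have "M ** X = ctranspose (M ** X)"
    using X by (simp add: is_pseudo_inverse_def)
  also have "\<dots> = ctranspose ((M ** Y) ** (M ** X))"
    using Y by (simp add: is_pseudo_inverse_def matrix_mul_assoc)
  also have "\<dots> = (M ** X) ** (M ** Y)"
    using X Y by (simp add: is_pseudo_inverse_def ctranspose_mult[of "M ** Y" "M ** X"])
  also have "\<dots> = M ** Y"
    using X by (simp add: is_pseudo_inverse_def matrix_mul_assoc)
  finally have MX: "M ** X = M ** Y" .
  have "X ** M = ctranspose (X ** M)"
    using X by (simp add: is_pseudo_inverse_def)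
  also have "\<dots> = ctranspose ((X ** M) ** (Y ** M))"
    using Y by (simp add: is_pseudo_inverse_def flip: matrix_mul_assoc)
  also have "\<dots> = (Y ** M) ** (X ** M)"
    using X Y by (simp add: is_pseudo_inverse_def ctranspose_mult[of "X ** M" "Y ** M"])
  also have "\<dots> = Y ** M"
    using X by (simp add: is_pseudo_inverse_def flip: matrix_mul_assoc)
  finally have XM: "X ** M = Y ** M" .
  have "X = X ** M ** X"
    using X by (simp add: is_pseudo_inverse_def)
  also have "\<dots> = Y ** (M ** X)"
    by (simp add: XM flip: matrix_mul_assoc)
  also have "\<dots> = Y"
    using Y by (simp add: MX is_pseudo_inverse_def matrix_mul_assoc)
  finally show ?thesis .
qed

definition pseudo_inverse :: "complex ^ 'b ^ 'a \<Rightarrow> complex ^ 'a ^ 'b"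
  where "pseudo_inverse M = (THE X. is_pseudo_inverse M X)"

lemma pseudo_inverse_eqI: "is_pseudo_inverse M X \<Longrightarrow> pseudo_inverse M = X"
  unfolding pseudo_inverse_def by (blast intro: is_pseudo_inverse_unique)

definition append_columns ::
    "complex ^ 'k ^ 'n \<Rightarrow> complex ^ 'm ^ 'n \<Rightarrow> complex ^ ('k + 'm) ^ 'n"
  where "append_columns U V = (\<chi> i j. case j of Inl a \<Rightarrow> U $ i $ a | Inr b \<Rightarrow> V $ i $ b)"

definition matrix_range :: "complex ^ 'b ^ 'a \<Rightarrow> (complex ^ 'a) set"
  where "matrix_range M = range ((*v) M)"

text \<open>Since \<open>columns M\<close> is a set, independence of the family of columns also requires
  that no column is repeated. \<open>vec.independent\<close> is independence over \<open>\<complex>\<close>, whereas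
  \<open>independent\<close> would be independence over \<open>\<real>\<close>.\<close>

definition independent_columns :: "complex ^ 'b ^ 'a \<Rightarrow> bool"
  where "independent_columns M \<longleftrightarrow> inj (\<lambda>j. column j M) \<and> vec.independent (columns M)"

definition sketching_assumption :: "real \<Rightarrow> complex ^ 'n ^ 's \<Rightarrow> (complex ^ 'n) set \<Rightarrow> bool"
  where "sketching_assumption \<epsilon> S W \<longleftrightarrow>
    (\<forall>v\<in>W. (1 - \<epsilon>) * (norm v)\<^sup>2 \<le> (norm (S *v v))\<^sup>2 \<and>
           (norm (S *v v))\<^sup>2 \<le> (1 + \<epsilon>) * (norm v)\<^sup>2)"

text \<open>\<open>t\<close> is a sketched GMRES approximation to a solution of \<open>B t = c\<close>, with sketching
  matrix \<open>S\<close>, initial guess \<open>t0\<close> and correction space \<open>W\<close>. Augmented sketched GMRES is the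
  case where \<open>W\<close> is the augmented space.\<close>

definition sketched_GMRES ::
    "complex ^ 'n ^ 's \<Rightarrow> complex ^ 'n ^ 'n \<Rightarrow> complex ^ 'n \<Rightarrow> complex ^ 'n \<Rightarrow>
     (complex ^ 'n) set \<Rightarrow> complex ^ 'n \<Rightarrow> bool"
  where "sketched_GMRES S B c t0 W t \<longleftrightarrow>
    (\<exists>f. is_arg_min (\<lambda>f. norm (S *v (c - B *v (t0 + f)))) (\<lambda>f. f \<in> W) f \<and> t = t0 + f)"

definition Phi_hat ::
    "complex ^ 'n ^ 's \<Rightarrow> complex ^ 'n ^ 'n \<Rightarrow> complex ^ 'k ^ 'n \<Rightarrow> complex ^ 'n ^ 'n"
  where "Phi_hat S A U = A ** U ** pseudo_inverse (S ** A ** U) ** S"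

definition Pi_hat ::
    "complex ^ 'n ^ 's \<Rightarrow> complex ^ 'n ^ 'n \<Rightarrow> complex ^ 'k ^ 'n \<Rightarrow> complex ^ 'n ^ 'n"
  where "Pi_hat S A U = U ** pseudo_inverse (S ** A ** U) ** S ** A"

end

theory Submission
  imports Defs
begin

text \<open>Put \<open>M = SAU\<close>, \<open>W = SAV\<close> and \<open>c = Sr0\<close>. As \<open>MM\<^sup>\<dagger>\<close> is the orthogonal projector
  onto \<open>Range M\<close>, Pythagoras gives
  \<open>\<parallel>c - Mw - Wz\<parallel>\<^sup>2 = \<parallel>(I - MM\<^sup>\<dagger>)(c - Wz)\<parallel>\<^sup>2 + \<parallel>M(M\<^sup>\<dagger>(c - Wz) - w)\<parallel>\<^sup>2\<close>.
  For given \<open>z\<close> the last term vanishes exactly at \<open>w = M\<^sup>\<dagger>(c - Wz)\<close>, which is where the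
  correction by \<open>Pi_hat\<close> comes from, and the remaining minimization over \<open>z\<close> is the projected
  problem, because \<open>S(I - Phi_hat) = (I - MM\<^sup>\<dagger>)S\<close>.\<close>

text \<open>On complex vectors \<open>\<bullet>\<close> is the real part of the Hermitian inner
  product; the conjugate transpose is an adjoint for it too, so real orthogonality suffices for
  Pythagoras.\<close>

lemma inner_matrix_vector_mult:
  fixes M :: "complex ^ 'b ^ 'a"
  shows "(M *v x) \<bullet> y = x \<bullet> (ctranspose M *v y)"
proof -
  have "(M *v x) \<bullet> y = (\<Sum>i\<in>UNIV. \<Sum>j\<in>UNIV. (M$i$j * x$j) \<bullet> y$i)"
    by (simp add: inner_vec_def matrix_vector_mult_def inner_sum_left)
  also have "\<dots> = (\<Sum>j\<in>UNIV. \<Sum>i\<in>UNIV. x$j \<bullet> (cnj (M$i$j) * y$i))"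
    by (subst sum.swap) (simp add: inner_complex_def algebra_simps)
  also have "\<dots> = x \<bullet> (ctranspose M *v y)"
    by (simp add: inner_vec_def matrix_vector_mult_def ctranspose_def inner_sum_right)
  finally show ?thesis .
qed

lemma ctranspose_ctranspose [simp]: "ctranspose (ctranspose M) = M"
  by (simp add: ctranspose_def vec_eq_iff)

lemma ctranspose_mat_1 [simp]: "ctranspose (mat 1) = mat 1"
  by (auto simp: ctranspose_def mat_def vec_eq_iff)

lemma independent_columns_kernel:
  assumes "independent_columns M" and "M *v x = 0"
  shows "x = 0"
proof -
  have inj: "inj (\<lambda>j. column j M)" and indep: "vec.independent (columns M)"
    using assms(1) by (auto simp: independent_columns_def)
  \<comment> \<open>Independence of a set takes coefficients indexed by vectors, so the entries of
    \<open>x\<close> are carried over to the columns; injectivity makes this well defined.\<close>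
  define c where "c v = x $ inv (\<lambda>j. column j M) v" for v
  have c: "c (column j M) = x $ j" for j
    by (simp add: c_def inv_f_f[OF inj])
  have columns: "columns M = range (\<lambda>j. column j M)"
    by (auto simp: columns_def)
  have "(\<Sum>v\<in>columns M. c v *s v) = (\<Sum>j\<in>UNIV. x $ j *s column j M)"
    unfolding columns by (simp add: sum.reindex[OF inj] c)
  also have "\<dots> = 0"
    using assms(2) by (simp add: matrix_mult_sum)
  finally have "c (column j M) = 0" for j
    using indep vec.independentD[of "columns M" "columns M" c "column j M"]
    by (auto simp: columns)
  then show ?thesis
    by (simp add: c vec_eq_iff)
qed

text \<open>The Gram matrix \<open>M\<^sup>*M\<close> has trivial kernel because its quadratic form
  is the squared norm of \<open>M *v v\<close>. With \<open>G\<close> its inverse,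
  \<open>GM\<^sup>*\<close> satisfies the Penrose equations, which gives the existence that the
  \<open>THE\<close> in \<open>pseudo_inverse\<close> requires.\<close>

lemma pseudo_inverse_full_column_rank:
  fixes M :: "complex ^ 'b ^ 'a"
  assumes ker: "\<forall>v. M *v v = 0 \<longrightarrow> v = 0"
  shows "is_pseudo_inverse M (pseudo_inverse M)" and "pseudo_inverse M ** M = mat 1"
proof -
  have "v = 0" if "(ctranspose M ** M) *v v = 0" for v
  proof (rule ker[rule_format])
    have "(M *v v) \<bullet> (M *v v) = 0"
      using that by (simp add: inner_matrix_vector_mult matrix_vector_mul_assoc)
    then show "M *v v = 0"
      by simp
  qed
  then obtain G where left: "G ** (ctranspose M ** M) = mat 1"
    using matrix_left_invertible_ker by blast
  have right: "(ctranspose M ** M) ** ctranspose G = mat 1"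
    using arg_cong[OF left, of ctranspose] by (simp add: ctranspose_mult)
  have "ctranspose G = G ** (ctranspose M ** M) ** ctranspose G"
    by (simp add: left)
  also have "\<dots> = G"
    using right by (simp add: matrix_mul_assoc[symmetric])
  finally have herm: "ctranspose G = G" .
  have XM: "G ** ctranspose M ** M = mat 1"
    using left by (simp add: matrix_mul_assoc)
  have X: "is_pseudo_inverse M (G ** ctranspose M)"
    using XM by (simp add: is_pseudo_inverse_def ctranspose_mult herm matrix_mul_assoc)
      (simp add: matrix_mul_assoc[symmetric])
  show "is_pseudo_inverse M (pseudo_inverse M)" "pseudo_inverse M ** M = mat 1"
    using X XM by (simp_all add: pseudo_inverse_eqI[OF X])
qed

text \<open>Since \<open>MX\<close> is Hermitian and \<open>MXM = M\<close>, also
  \<open>M\<^sup>*MX = M\<^sup>*\<close>: the residual \<open>c - MXc\<close> is orthogonal to the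
  range of \<open>M\<close>.\<close>

lemma norm_residual_pseudo_inverse:
  assumes X: "is_pseudo_inverse M X"
  shows "(norm (c - M *v z))\<^sup>2 = (norm (c - M *v (X *v c)))\<^sup>2 + (norm (M *v (X *v c - z)))\<^sup>2"
proof -
  have "ctranspose M ** (M ** X) = ctranspose (M ** X ** M)"
    using X by (subst ctranspose_mult) (simp add: is_pseudo_inverse_def)
  then have "ctranspose M ** (M ** X) = ctranspose M"
    using X by (simp add: is_pseudo_inverse_def)
  then have "ctranspose M *v (c - M *v (X *v c)) = 0"
    by (simp add: matrix_vector_mult_diff_distrib matrix_vector_mul_assoc)
  then have "orthogonal (c - M *v (X *v c)) (M *v (X *v c - z))"
    by (simp add: orthogonal_def inner_commute[of "c - _"] inner_matrix_vector_mult)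
  from norm_add_Pythagorean[OF this] show ?thesis
    by (simp add: matrix_vector_mult_diff_distrib)
qed

text \<open>By Pythagoras the minimizers are the \<open>z\<close> with \<open>M(Xc - z) = 0\<close>,
  where \<open>X\<close> is the pseudoinverse; the trivial kernel leaves only
  \<open>Xc\<close>.\<close>

lemma is_arg_min_residual_iff:
  fixes M :: "complex ^ 'b ^ 'a"
  assumes ker: "\<forall>v. M *v v = 0 \<longrightarrow> v = 0"
  shows "is_arg_min (\<lambda>z. norm (c - M *v z)) (\<lambda>_. True) z \<longleftrightarrow> z = pseudo_inverse M *v c"
proof -
  let ?z = "pseudo_inverse M *v c"
  note pyth = norm_residual_pseudo_inverse[OF pseudo_inverse_full_column_rank(1)[OF ker]]
  have min: "norm (c - M *v ?z) \<le> norm (c - M *v u)" for u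
    by (rule power2_le_imp_le) (simp_all add: pyth[of c u])
  have "z = ?z" if "norm (c - M *v z) \<le> norm (c - M *v ?z)"
  proof -
    have "norm (c - M *v z) = norm (c - M *v ?z)"
      using that min[of z] by simp
    then have "M *v (?z - z) = 0"
      using pyth[of c z] by simp
    then show ?thesis
      using ker by fastforce
  qed
  with min show ?thesis
    by (auto simp: is_arg_min_def not_less)
qed

lemma is_arg_min_matrix_range_iff:
  "is_arg_min g (\<lambda>f. f \<in> matrix_range B) f \<longleftrightarrow>
    (\<exists>z. f = B *v z \<and> is_arg_min (\<lambda>z. g (B *v z)) (\<lambda>_. True) z)"
  by (auto simp: is_arg_min_def matrix_range_def)

definition append_vec :: "'a ^ 'k \<Rightarrow> 'a ^ 'm \<Rightarrow> 'a ^ ('k + 'm)"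
  where "append_vec w z = (\<chi> j. case j of Inl a \<Rightarrow> w $ a | Inr b \<Rightarrow> z $ b)"

lemma append_vec_exhaust: obtains w z where "q = append_vec w z"
proof
  show "q = append_vec (\<chi> a. q $ Inl a) (\<chi> b. q $ Inr b)"
    by (simp add: append_vec_def vec_eq_iff split: sum.split)
qed

lemma append_vec_eq_0_iff: "append_vec w z = 0 \<longleftrightarrow> w = 0 \<and> z = 0"
  by (simp add: append_vec_def vec_eq_iff split_sum_all)

lemma append_columns_mult_append_vec:
  "append_columns U V *v append_vec w z = U *v w + V *v z"
  by (simp add: append_columns_def append_vec_def matrix_vector_mult_def vec_eq_iff
      sum.Plus flip: UNIV_Plus_UNIV)

theorem theorem5p2:
  fixes A :: "complex ^ 'n ^ 'n" and b x x0 r0 \<eta>0 :: "complex ^ 'n"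
    and U :: "complex ^ 'k ^ 'n" and V :: "complex ^ 'm ^ 'n"
    and S :: "complex ^ 'n ^ 's" and \<epsilon> :: real
  assumes "A *v x = b"
    and "r0 = b - A *v x0"
    and "\<eta>0 = x - x0"
    and "0 \<le> \<epsilon>" and "\<epsilon> < 1"
    and "sketching_assumption \<epsilon> S (matrix_range (A ** U))"
    and "independent_columns (S ** A ** append_columns U V)"
  shows "\<exists>y :: complex ^ 'm.
     (\<forall>y'. is_arg_min (\<lambda>z. norm (S *v ((mat 1 - Phi_hat S A U) *v (r0 - A *v (V *v z)))))
             (\<lambda>_. True) y' \<longleftrightarrow> y' = y) \<and>
     (\<forall>t. sketched_GMRES S ((mat 1 - Phi_hat S A U) ** A) ((mat 1 - Phi_hat S A U) *v r0)
             0 (matrix_range V) t \<longleftrightarrow> t = V *v y) \<and>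
     (\<forall>xm. sketched_GMRES S A b x0 (matrix_range (append_columns U V)) xm \<longleftrightarrow>
             xm = x0 + Pi_hat S A U *v \<eta>0 + (mat 1 - Pi_hat S A U) *v (V *v y))"
proof -
  note mult_simps = matrix_vector_mult_diff_distrib matrix_vector_mult_diff_rdistrib
    matrix_vector_right_distrib matrix_vector_mul_assoc[symmetric]
  define M where "M = S ** A ** U"
  define W where "W = S ** A ** V"
  define X where "X = pseudo_inverse M"
  define Q where "Q = mat 1 - M ** X"
  define c where "c = S *v r0"
  define G where "G = S ** A ** append_columns U V"
  define y where "y = pseudo_inverse (Q ** W) *v (Q *v c)"
  define w where "w = X *v (c - W *v y)"
  have G: "G *v append_vec u z = M *v u + W *v z" for u z
    by (simp add: G_def M_def W_def append_columns_mult_append_vec mult_simps)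
  have G_ker: "\<forall>q. G *v q = 0 \<longrightarrow> q = 0"
    using independent_columns_kernel assms(7) by (auto simp: G_def)
  have ker: "u = 0 \<and> z = 0" if "M *v u + W *v z = 0" for u z
    using G_ker[rule_format, of "append_vec u z"] that by (simp add: G append_vec_eq_0_iff)
  have M_ker: "\<forall>u. M *v u = 0 \<longrightarrow> u = 0"
    using ker[of _ 0] by simp
  \<comment> \<open>If \<open>QWz = 0\<close> then \<open>Wz = MXWz\<close>, so the block vector of
    \<open>-XWz\<close> and \<open>z\<close> lies in the kernel of \<open>G\<close>.\<close>
  have QW_ker: "\<forall>z. (Q ** W) *v z = 0 \<longrightarrow> z = 0"
    using ker[of "- (X *v (W *v z))" z for z]
    by (simp add: Q_def mult_simps vec.neg)
  have X: "is_pseudo_inverse M X"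
    unfolding X_def by (rule pseudo_inverse_full_column_rank(1)[OF M_ker])

  have projected: "S *v ((mat 1 - Phi_hat S A U) *v (r0 - A *v (V *v z)))
      = Q *v c - (Q ** W) *v z" for z
    by (simp add: Phi_hat_def Q_def W_def c_def X_def M_def mult_simps)
  have y: "is_arg_min (\<lambda>z. norm (Q *v c - (Q ** W) *v z)) (\<lambda>_. True) z \<longleftrightarrow> z = y" for z
    unfolding y_def by (rule is_arg_min_residual_iff[OF QW_ker])

  have t: "sketched_GMRES S ((mat 1 - Phi_hat S A U) ** A) ((mat 1 - Phi_hat S A U) *v r0)
      0 (matrix_range V) t \<longleftrightarrow> t = V *v y" for t
  proof -
    have "S *v ((mat 1 - Phi_hat S A U) *v r0 - ((mat 1 - Phi_hat S A U) ** A) *v (0 + V *v z))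
        = Q *v c - (Q ** W) *v z" for z
      unfolding projected[symmetric] by (simp add: mult_simps)
    then show ?thesis
      by (simp add: sketched_GMRES_def is_arg_min_matrix_range_iff y)
  qed

  \<comment> \<open>The residual is \<open>(c - Wz) - Mu\<close>, a least-squares residual for
    \<open>M\<close> with right-hand side \<open>c - Wz\<close>.\<close>
  have split: "(norm (c - G *v append_vec u z))\<^sup>2
      = (norm (Q *v c - (Q ** W) *v z))\<^sup>2 + (norm (M *v (X *v (c - W *v z) - u)))\<^sup>2" for u z
    using norm_residual_pseudo_inverse[OF X, of "c - W *v z" u]
    by (simp add: G Q_def mult_simps algebra_simps)
  have "is_arg_min (\<lambda>q. norm (c - G *v q)) (\<lambda>_. True) (append_vec w y)"
  proof -
    have "norm (c - G *v append_vec w y) \<le> norm (c - G *v q)" for q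
    proof -
      obtain u z where q: "q = append_vec u z"
        by (rule append_vec_exhaust)
      have "norm (Q *v c - (Q ** W) *v y) \<le> norm (Q *v c - (Q ** W) *v z)"
        using y[of y] by (simp add: is_arg_min_def not_less)
      then have "(norm (Q *v c - (Q ** W) *v y))\<^sup>2 \<le> (norm (Q *v c - (Q ** W) *v z))\<^sup>2"
        by (simp add: power_mono)
      then have "(norm (c - G *v append_vec w y))\<^sup>2 \<le> (norm (c - G *v q))\<^sup>2"
        unfolding q split by (simp add: w_def add_increasing2)
      then show ?thesis
        by (rule power2_le_imp_le) simp
    qed
    then show ?thesis
      by (simp add: is_arg_min_def not_less)
  qed
  \<comment> \<open>\<open>G\<close> has trivial kernel, so its least-squares problem has a single
    minimizer, which must be the one just found; the pseudoinverse of \<open>G\<close> is never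
    computed.\<close>
  then have aug: "is_arg_min (\<lambda>q. norm (c - G *v q)) (\<lambda>_. True) q \<longleftrightarrow> q = append_vec w y" for q
    using is_arg_min_residual_iff[OF G_ker, of c] by simp
  have "sketched_GMRES S A b x0 (matrix_range (append_columns U V)) xm \<longleftrightarrow>
      xm = x0 + (U *v w + V *v y)" for xm
  proof -
    have "S *v (b - A *v (x0 + append_columns U V *v q)) = c - G *v q" for q
      by (simp add: c_def G_def assms(2) mult_simps)
    then show ?thesis
      by (simp add: sketched_GMRES_def is_arg_min_matrix_range_iff aug
          append_columns_mult_append_vec)
  qed
  \<comment> \<open>As \<open>r0 = A\<eta>0\<close>, the vector \<open>w\<close> equals
    \<open>XSA(\<eta>0 - Vy)\<close>, hence \<open>Uw\<close> is \<open>Pi_hat\<close> applied to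
    \<open>\<eta>0 - Vy\<close>.\<close>
  moreover have "x0 + (U *v w + V *v y)
      = x0 + Pi_hat S A U *v \<eta>0 + (mat 1 - Pi_hat S A U) *v (V *v y)"
  proof -
    have "r0 = A *v \<eta>0"
      using assms(1-3) by (simp add: mult_simps)
    then show ?thesis
      by (simp add: w_def c_def W_def X_def M_def Pi_hat_def mult_simps)
  qed
  ultimately show ?thesis
    using y t unfolding projected by (intro exI[of _ y]) simp
qed

end
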